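(* Let $B$ be an $n$-vertex stacked $d$-ball. If $d\ge 2$ and $n\ge d+2$, then $B$ is a subcomplex of an $n$-vertex stacked $d$-sphere $S$ (so $B$ and $S$ have the same vertex set).
   Context: Simplicial complexes are finite and abstract; isomorphic complexes are identified. An $n$-vertex complex is one with exactly $n$ vertices. A complex is pure if all its maximal faces have the same dimension; in a pure $k$-dimensional complex, faces of dimension $k$ are facets and faces of dimension $k-1$ are ridges. For a face $\sigma$, $\overline{\sigma}$ denotes the complex consisting of $\sigma$ and all its faces. A standard $k$-ball is a complex $\overline{\sigma}$ with $\sigma$ a $k$-simplex. A simplicial complex $B$ is a stacked $k$-ball if there is a sequence $B_1,\dots,B_m$ of pure simplicial complexes such that $B_1$ is a standard $k$-ball, $B_m=B$ and, for $2\le i\le m$, $B_i=B_{i-1}\cup\overline{\sigma}_i$ and $B_{i-1}\cap\overline{\sigma}_i=\overline{\tau}_i$, where $\sigma_i$ is a facet of $B_i$ and $\tau_i$ is a ridge of $B_i$ that lies in exactly one facet of $B_{i-1}$. The boundary of a stacked $k$-ball $B$ is the pure $(k-1)$-dimensional complex whose facets are the ridges of $B$ lying in exactly one facet of $B$. A stacked $k$-sphere is a complex isomorphic to the boundary of a stacked $(k+1)$-ball. *)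

theory Defs
  imports Main
begin

text \<open>
  Finite abstract simplicial complexes, as families of faces. The empty set counts as a face
  (of dimension \<open>-1\<close>), so the complex generated by a face \<open>\<sigma>\<close> is \<open>Pow \<sigma>\<close>, and a face of
  dimension \<open>k\<close> has \<open>k + 1\<close> elements.
\<close>

definition abstract_complex :: "'a set set \<Rightarrow> bool" where
  "abstract_complex K \<longleftrightarrow>
     finite K \<and> K \<noteq> {} \<and> (\<forall>\<sigma>\<in>K. finite \<sigma>) \<and> (\<forall>\<sigma>\<in>K. \<forall>\<tau>. \<tau> \<subseteq> \<sigma> \<longrightarrow> \<tau> \<in> K)"

definition complex_vertices :: "'a set set \<Rightarrow> 'a set" where
  "complex_vertices K = {v. {v} \<in> K}"

definition subcomplex :: "'a set set \<Rightarrow> 'a set set \<Rightarrow> bool" where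
  "subcomplex K L \<longleftrightarrow> abstract_complex K \<and> abstract_complex L \<and> K \<subseteq> L"

definition isomorphic_complexes :: "'a set set \<Rightarrow> 'b set set \<Rightarrow> bool" where
  "isomorphic_complexes K L \<longleftrightarrow>
     abstract_complex K \<and> abstract_complex L \<and>
     (\<exists>f. bij_betw f (complex_vertices K) (complex_vertices L) \<and> L = (\<lambda>\<sigma>. f ` \<sigma>) ` K)"

definition maximal_face :: "'a set set \<Rightarrow> 'a set \<Rightarrow> bool" where
  "maximal_face K \<sigma> \<longleftrightarrow> \<sigma> \<in> K \<and> (\<forall>\<tau>\<in>K. \<sigma> \<subseteq> \<tau> \<longrightarrow> \<tau> = \<sigma>)"

definition pure_complex :: "nat \<Rightarrow> 'a set set \<Rightarrow> bool" where
  "pure_complex k K \<longleftrightarrow> abstract_complex K \<and> (\<forall>\<sigma>. maximal_face K \<sigma> \<longrightarrow> card \<sigma> = k + 1)"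

text \<open>The next three notions are meant for pure \<open>k\<close>-dimensional complexes.\<close>

definition facets :: "nat \<Rightarrow> 'a set set \<Rightarrow> 'a set set" where
  "facets k K = {\<sigma> \<in> K. card \<sigma> = k + 1}"

definition ridges :: "nat \<Rightarrow> 'a set set \<Rightarrow> 'a set set" where
  "ridges k K = {\<tau> \<in> K. card \<tau> = k}"

definition in_exactly_one_facet :: "nat \<Rightarrow> 'a set set \<Rightarrow> 'a set \<Rightarrow> bool" where
  "in_exactly_one_facet k K \<tau> \<longleftrightarrow> (\<exists>!\<sigma>. \<sigma> \<in> facets k K \<and> \<tau> \<subseteq> \<sigma>)"

definition standard_ball :: "nat \<Rightarrow> 'a set set \<Rightarrow> bool" where
  "standard_ball k K \<longleftrightarrow> (\<exists>\<sigma>. finite \<sigma> \<and> card \<sigma> = k + 1 \<and> K = Pow \<sigma>)"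

text \<open>
  All members of the sequence are pure of the same dimension \<open>k\<close>. Purity alone would permit
  the step from a standard \<open>k\<close>-ball to a standard \<open>(k + 1)\<close>-ball containing it.
\<close>

definition stacked_ball :: "nat \<Rightarrow> 'a set set \<Rightarrow> bool" where
  "stacked_ball k B \<longleftrightarrow>
     (\<exists>(m::nat) (Bs :: nat \<Rightarrow> 'a set set).
        m \<ge> 1 \<and>
        (\<forall>i\<in>{1..m}. pure_complex k (Bs i)) \<and>
        standard_ball k (Bs 1) \<and>
        Bs m = B \<and>
        (\<forall>i\<in>{2..m}. \<exists>\<sigma> \<tau>.
           \<sigma> \<in> facets k (Bs i) \<and>
           \<tau> \<in> ridges k (Bs i) \<and>
           in_exactly_one_facet k (Bs (i - 1)) \<tau> \<and>
           Bs i = Bs (i - 1) \<union> Pow \<sigma> \<and>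
           Bs (i - 1) \<inter> Pow \<sigma> = Pow \<tau>))"

definition ball_boundary :: "nat \<Rightarrow> 'a set set \<Rightarrow> 'a set set" where
  "ball_boundary k B = (\<Union>\<tau>\<in>{\<tau> \<in> ridges k B. in_exactly_one_facet k B \<tau>}. Pow \<tau>)"

text \<open>
  Every finite complex has an isomorphic copy with vertices in \<open>nat\<close>, so letting the
  bounding ball range over complexes on \<open>nat\<close> loses no generality, whatever the vertex type of \<open>S\<close>.
\<close>

definition stacked_sphere :: "nat \<Rightarrow> 'a set set \<Rightarrow> bool" where
  "stacked_sphere k S \<longleftrightarrow>
     (\<exists>B :: nat set set. stacked_ball (k + 1) B \<and>
        isomorphic_complexes S (ball_boundary (k + 1) B))"

end

theory Submission
  imports Defs
begin

text \<open>
  By induction along the stacking of \<open>B\<close>, we build a stacked \<open>(d + 1)\<close>-ball \<open>C\<close> on the vertices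
  of \<open>B\<close> with \<open>B \<subseteq> \<partial>C\<close>. Two adjacent facets of \<open>B\<close> span the first simplex of \<open>C\<close>. When a new
  facet \<open>\<tau> \<union> {v}\<close> is glued to \<open>B\<close> along \<open>\<tau>\<close>, the ridge \<open>\<tau>\<close> of \<open>\<partial>C\<close> lies in at least two facets
  of \<open>\<partial>C\<close>, but in only one facet of \<open>B\<close>. So there is a facet \<open>\<rho> \<supseteq> \<tau>\<close> of \<open>\<partial>C\<close> outside \<open>B\<close>, and gluing
  the simplex \<open>\<rho> \<union> {v}\<close> to \<open>C\<close> removes only \<open>\<rho>\<close> from the boundary and puts \<open>\<tau> \<union> {v}\<close> into it.
\<close>

section \<open>Faces, purity and facets\<close>

text \<open>The generators of \<open>ball_boundary k B\<close>, separated from their faces. A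
  stacking step changes this set by a simple exchange, which is easier to follow than the change of
  the whole boundary complex.\<close>

definition boundary_facets :: "nat \<Rightarrow> 'a set set \<Rightarrow> 'a set set" where
  "boundary_facets k B = {\<tau> \<in> B. card \<tau> = k \<and> in_exactly_one_facet k B \<tau>}"

lemma ball_boundary_eq: "ball_boundary k B = (\<Union>\<tau>\<in>boundary_facets k B. Pow \<tau>)"
  by (auto simp: ball_boundary_def boundary_facets_def ridges_def)

lemma abstract_complexD:
  assumes "abstract_complex K"
  shows "finite K" "K \<noteq> {}" "\<And>\<sigma>. \<sigma> \<in> K \<Longrightarrow> finite \<sigma>"
    "\<And>\<sigma> \<tau>. \<sigma> \<in> K \<Longrightarrow> \<tau> \<subseteq> \<sigma> \<Longrightarrow> \<tau> \<in> K"
  using assms unfolding abstract_complex_def by blast+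

lemma complex_vertices_eq_Union:
  assumes "abstract_complex K"
  shows "complex_vertices K = \<Union>K"
proof
  show "complex_vertices K \<subseteq> \<Union>K" by (auto simp: complex_vertices_def)
  show "\<Union>K \<subseteq> complex_vertices K"
  proof
    fix v assume "v \<in> \<Union>K"
    then obtain \<sigma> where "\<sigma> \<in> K" "{v} \<subseteq> \<sigma>" by auto
    then have "{v} \<in> K" using abstract_complexD(4)[OF assms] by blast
    then show "v \<in> complex_vertices K" by (simp add: complex_vertices_def)
  qed
qed

lemma pure_complex_Pow:
  assumes "finite \<sigma>" "card \<sigma> = k + 1"
  shows "pure_complex k (Pow \<sigma>)"
  using assms
  by (auto simp: pure_complex_def abstract_complex_def maximal_face_def intro: finite_subset)

lemma pure_complex_extend:
  assumes "pure_complex k B" "finite \<sigma>" "card \<sigma> = k + 1"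
  shows "pure_complex k (B \<union> Pow \<sigma>)"
  unfolding pure_complex_def
proof (intro conjI allI impI)
  have "abstract_complex B" using assms(1) by (simp add: pure_complex_def)
  then show "abstract_complex (B \<union> Pow \<sigma>)"
    using assms(2) unfolding abstract_complex_def by (auto intro: finite_subset)
  fix \<rho> assume "maximal_face (B \<union> Pow \<sigma>) \<rho>"
  then have "\<rho> = \<sigma> \<or> maximal_face B \<rho>" by (auto simp: maximal_face_def)
  then show "card \<rho> = k + 1" using assms by (auto simp: pure_complex_def)
qed

lemma pure_complex_face_in_facet:
  assumes "pure_complex k B" "\<tau> \<in> B"
  obtains \<sigma> where "\<sigma> \<in> facets k B" "\<tau> \<subseteq> \<sigma>"
proof -
  have "finite B" using assms(1) by (simp add: pure_complex_def abstract_complex_def)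
  then obtain \<sigma> where \<sigma>: "\<sigma> \<in> B" "\<tau> \<subseteq> \<sigma>" "\<forall>\<rho>\<in>B. \<sigma> \<subseteq> \<rho> \<longrightarrow> \<rho> = \<sigma>"
    using finite_has_maximal2[of B \<tau>] assms(2) by metis
  then have "maximal_face B \<sigma>" by (simp add: maximal_face_def)
  then have "\<sigma> \<in> facets k B" using assms(1) by (simp add: pure_complex_def facets_def maximal_face_def)
  with \<sigma>(2) show thesis using that by blast
qed

section \<open>Stacking as coning a free ridge from a new vertex\<close>

text \<open>One link of the sequence in \<open>stacked_ball\<close>, from \<open>Bs (i - 1)\<close>
  to \<open>Bs i\<close>. The clause is copied literally, so that \<open>stacked_ball_iff\<close> is
  a mere folding of definitions.\<close>

definition stacking_step :: "nat \<Rightarrow> 'a set set \<Rightarrow> 'a set set \<Rightarrow> bool" where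
  "stacking_step k B B' \<longleftrightarrow> (\<exists>\<sigma> \<tau>. \<sigma> \<in> facets k B' \<and> \<tau> \<in> ridges k B' \<and>
     in_exactly_one_facet k B \<tau> \<and> B' = B \<union> Pow \<sigma> \<and> B \<inter> Pow \<sigma> = Pow \<tau>)"

lemma stacked_ball_iff:
  "stacked_ball k B \<longleftrightarrow> (\<exists>(m::nat) Bs. m \<ge> 1 \<and> (\<forall>i\<in>{1..m}. pure_complex k (Bs i)) \<and>
     standard_ball k (Bs 1) \<and> Bs m = B \<and> (\<forall>i\<in>{2..m}. stacking_step k (Bs (i - 1)) (Bs i)))"
  by (simp only: stacked_ball_def stacking_step_def)

lemma stacked_ball_pure: "stacked_ball k B \<Longrightarrow> pure_complex k B"
  unfolding stacked_ball_def by (metis atLeastAtMost_iff order_refl)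

lemma stacked_ball_complex: "stacked_ball k B \<Longrightarrow> abstract_complex B"
  using stacked_ball_pure by (auto simp: pure_complex_def)

lemma stacked_ball_Pow:
  assumes "finite \<sigma>" "card \<sigma> = k + 1"
  shows "stacked_ball k (Pow \<sigma>)"
  unfolding stacked_ball_def standard_ball_def
  by (rule exI[of _ 1], rule exI[of _ "\<lambda>_. Pow \<sigma>"]) (use assms pure_complex_Pow in auto)

text \<open>As \<open>v\<close> is new, the only faces of \<open>insert v \<tau>\<close> already in
  \<open>B\<close> are those of \<open>\<tau>\<close>, which is the gluing condition. The sequence
  for \<open>B\<close> is then prolonged by one term.\<close>

lemma stacked_ball_extend:
  assumes B: "stacked_ball k B" and \<tau>: "\<tau> \<in> boundary_facets k B" and v: "v \<notin> \<Union>B"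
  shows "stacked_ball k (B \<union> Pow (insert v \<tau>))"
proof -
  let ?\<sigma> = "insert v \<tau>"
  let ?B = "B \<union> Pow ?\<sigma>"
  note c = abstract_complexD[OF stacked_ball_complex[OF B]]
  have \<tau>B: "\<tau> \<in> B" "card \<tau> = k" "in_exactly_one_facet k B \<tau>"
    using \<tau> by (auto simp: boundary_facets_def)
  have fin: "finite ?\<sigma>" and card: "card ?\<sigma> = k + 1"
    using c(3)[OF \<tau>B(1)] \<tau>B v by (auto simp: card_insert_if)
  have pure: "pure_complex k ?B"
    using pure_complex_extend[OF stacked_ball_pure[OF B] fin card] .
  have "?\<sigma> \<in> facets k ?B" "\<tau> \<in> ridges k ?B" "B \<inter> Pow ?\<sigma> = Pow \<tau>"
    using card \<tau>B c(4) v by (auto simp: facets_def ridges_def)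
  then have step: "stacking_step k B ?B" using \<tau>B unfolding stacking_step_def by blast
  obtain m :: nat and Bs where m: "m \<ge> 1" "\<forall>i\<in>{1..m}. pure_complex k (Bs i)" "standard_ball k (Bs 1)"
      "Bs m = B"
    and steps: "\<forall>i\<in>{2..m}. stacking_step k (Bs (i - 1)) (Bs i)"
    using B by (auto simp only: stacked_ball_iff)
  define Bs' where "Bs' = Bs(Suc m := ?B)"
  have old: "Bs' i = Bs i" if "i \<le> m" for i using that by (simp add: Bs'_def)
  have new: "Bs' (Suc m) = ?B" by (simp add: Bs'_def)
  have "stacking_step k (Bs' (i - 1)) (Bs' i)" if "i \<in> {2..Suc m}" for i
  proof (cases "i = Suc m")
    case True
    have "Bs' (i - 1) = B" "Bs' i = ?B" using True old m(4) new by auto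
    then show ?thesis using step by simp
  next
    case False
    then have "i \<in> {2..m}" using that by auto
    moreover from this have "Bs' i = Bs i" "Bs' (i - 1) = Bs (i - 1)" by (auto intro!: old)
    ultimately show ?thesis using steps by simp
  qed
  moreover have "\<forall>i\<in>{1..Suc m}. pure_complex k (Bs' i)"
    using m(2) pure by (auto simp: Bs'_def)
  moreover have "standard_ball k (Bs' 1)" using m old by auto
  ultimately show ?thesis unfolding stacked_ball_iff using new
    by (intro exI[of _ "Suc m"] exI[of _ Bs']) auto
qed

text \<open>Removes the sequence from later arguments. By cardinality the glued facet is
  \<open>insert v \<tau>\<close> for a single \<open>v\<close> outside \<open>\<tau>\<close>. This
  \<open>v\<close> is new: otherwise \<open>{v}\<close> would be a common face of the old ball and
  the glued simplex, hence a face of \<open>\<tau>\<close>.\<close>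

lemma stacked_ball_induct [consumes 1, case_names Pow extend]:
  assumes B: "stacked_ball k B"
    and base: "\<And>\<sigma>. finite \<sigma> \<Longrightarrow> card \<sigma> = k + 1 \<Longrightarrow> P (Pow \<sigma>)"
    and ext: "\<And>B \<tau> v. stacked_ball k B \<Longrightarrow> P B \<Longrightarrow> \<tau> \<in> boundary_facets k B \<Longrightarrow> v \<notin> \<Union>B \<Longrightarrow>
      P (B \<union> Pow (insert v \<tau>))"
  shows "P B"
proof -
  obtain m :: nat and Bs where m: "m \<ge> 1" "\<forall>i\<in>{1..m}. pure_complex k (Bs i)" "standard_ball k (Bs 1)"
      "Bs m = B"
    and steps: "\<forall>i\<in>{2..m}. stacking_step k (Bs (i - 1)) (Bs i)"
    using B by (auto simp only: stacked_ball_iff)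
  \<comment> \<open>The claim carries \<open>stacked_ball\<close> along with \<open>P\<close>,
    because \<open>ext\<close> assumes it of the smaller ball.\<close>
  have "i \<le> m \<longrightarrow> stacked_ball k (Bs i) \<and> P (Bs i)" if "1 \<le> i" for i
    using that
  proof (induction i rule: dec_induct)
    case base
    show ?case using m(3) assms(2) stacked_ball_Pow by (auto simp: standard_ball_def)
  next
    case (step i)
    show ?case
    proof
      assume i: "Suc i \<le> m"
      then have IH: "stacked_ball k (Bs i)" "P (Bs i)" using step.IH by auto
      have "Suc i \<in> {2..m}" using i step.hyps by auto
      from bspec[OF steps this] obtain \<sigma> \<tau> where st:
        "\<sigma> \<in> facets k (Bs (Suc i))" "\<tau> \<in> ridges k (Bs (Suc i))"
        "in_exactly_one_facet k (Bs i) \<tau>"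
        "Bs (Suc i) = Bs i \<union> Pow \<sigma>" "Bs i \<inter> Pow \<sigma> = Pow \<tau>"
        unfolding stacking_step_def by auto
      note c = abstract_complexD[OF stacked_ball_complex[OF IH(1)]]
      have \<tau>: "\<tau> \<in> Bs i" "\<tau> \<subseteq> \<sigma>" using st(5) by auto
      have "card \<tau> = k" "card \<sigma> = k + 1" using st by (auto simp: ridges_def facets_def)
      then have "card (\<sigma> - \<tau>) = 1" using \<tau> c(3) by (simp add: card_Diff_subset)
      then obtain v where "\<sigma> - \<tau> = {v}" by (auto simp: card_1_singleton_iff)
      then have v: "\<sigma> = insert v \<tau>" "v \<notin> \<tau>" using \<tau> by auto
      have "v \<notin> \<Union>(Bs i)"
      proof
        assume "v \<in> \<Union>(Bs i)"
        then have "{v} \<in> Bs i \<inter> Pow \<sigma>" using c(4) v by auto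
        then show False using st(5) v by auto
      qed
      moreover have "\<tau> \<in> boundary_facets k (Bs i)"
        using \<tau> st(3) \<open>card \<tau> = k\<close> by (simp add: boundary_facets_def)
      ultimately show "stacked_ball k (Bs (Suc i)) \<and> P (Bs (Suc i))"
        using ext stacked_ball_extend IH st(4) v(1) by metis
    qed
  qed
  then show ?thesis using m by auto
qed

section \<open>Facets and boundary under stacking\<close>

lemma facets_Pow:
  assumes "finite \<sigma>" "card \<sigma> = k + 1"
  shows "facets k (Pow \<sigma>) = {\<sigma>}"
  using assms by (auto simp: facets_def dest: card_subset_eq)

lemma boundary_facets_Pow:
  assumes "finite \<sigma>" "card \<sigma> = k + 1"
  shows "boundary_facets k (Pow \<sigma>) = {\<tau>. \<tau> \<subseteq> \<sigma> \<and> card \<tau> = k}"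
  using facets_Pow[OF assms] by (auto simp: boundary_facets_def in_exactly_one_facet_def)

lemma facets_extend:
  assumes B: "stacked_ball k B" and \<rho>: "\<rho> \<in> boundary_facets k B" and v: "v \<notin> \<Union>B"
  shows "facets k (B \<union> Pow (insert v \<rho>)) = insert (insert v \<rho>) (facets k B)"
proof -
  have "finite \<rho>" "card \<rho> = k" "v \<notin> \<rho>"
    using abstract_complexD(3)[OF stacked_ball_complex[OF B]] \<rho> v
    by (auto simp: boundary_facets_def)
  then have "facets k (Pow (insert v \<rho>)) = {insert v \<rho>}" by (intro facets_Pow) auto
  then show ?thesis by (auto simp: facets_def)
qed

text \<open>A ridge through \<open>v\<close> can only lie in the new facet, so it is free. The ridge
  \<open>\<rho>\<close> acquires a second facet and is lost. Any other \<open>k\<close>-set avoiding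
  \<open>v\<close> is not inside \<open>insert v \<rho>\<close>, since it would be a subset of
  \<open>\<rho>\<close> of equal size; its status is unchanged.\<close>

lemma boundary_facets_extend:
  assumes B: "stacked_ball k B" and \<rho>: "\<rho> \<in> boundary_facets k B" and v: "v \<notin> \<Union>B"
  shows "boundary_facets k (B \<union> Pow (insert v \<rho>)) =
    (boundary_facets k B - {\<rho>}) \<union> {\<tau>. v \<in> \<tau> \<and> \<tau> \<subseteq> insert v \<rho> \<and> card \<tau> = k}"
    (is "boundary_facets k ?B = ?R")
proof (rule set_eqI)
  fix \<tau>
  note c = abstract_complexD[OF stacked_ball_complex[OF B]]
  note F = facets_extend[OF assms]
  have \<rho>B: "\<rho> \<in> B" "card \<rho> = k" "in_exactly_one_facet k B \<rho>" "finite \<rho>" "v \<notin> \<rho>"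
    using \<rho> c v by (auto simp: boundary_facets_def)
  have FB: "facets k B \<subseteq> B" by (auto simp: facets_def)
  show "\<tau> \<in> boundary_facets k ?B \<longleftrightarrow> \<tau> \<in> ?R"
  proof (cases "v \<in> \<tau>")
    case True
    then have "\<not> \<tau> \<subseteq> \<sigma>" if "\<sigma> \<in> facets k B" for \<sigma> using that FB v by blast
    then have "in_exactly_one_facet k ?B \<tau> \<longleftrightarrow> \<tau> \<subseteq> insert v \<rho>"
      unfolding in_exactly_one_facet_def F by blast
    moreover have "\<tau> \<notin> B" using True v by auto
    ultimately show ?thesis using True by (auto simp: boundary_facets_def)
  next
    case False
    then have mem: "\<tau> \<in> ?B \<longleftrightarrow> \<tau> \<in> B" using \<rho>B c(4) by auto
    show ?thesis
    proof (cases "\<tau> = \<rho>")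
      case True
      obtain \<sigma> where "\<sigma> \<in> facets k B" "\<rho> \<subseteq> \<sigma>"
        using \<rho>B(3) by (auto simp: in_exactly_one_facet_def)
      moreover from this have "\<sigma> \<noteq> insert v \<rho>" using FB v by auto
      ultimately have "\<not> in_exactly_one_facet k ?B \<rho>"
        unfolding in_exactly_one_facet_def F by blast
      then show ?thesis using True False by (auto simp: boundary_facets_def)
    next
      case neq: False
      have "\<not> \<tau> \<subseteq> insert v \<rho>" if "card \<tau> = k"
        using that neq False \<rho>B card_subset_eq[of \<rho> \<tau>] by auto
      then have "in_exactly_one_facet k ?B \<tau> \<longleftrightarrow> in_exactly_one_facet k B \<tau>" if "card \<tau> = k"
        using that unfolding in_exactly_one_facet_def F by blast
      then show ?thesis using mem neq False by (auto simp: boundary_facets_def)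
    qed
  qed
qed

section \<open>The boundary of a stacked ball has no free ridges\<close>

text \<open>The diamond property of the face lattice of a simplex: \<open>A\<close> has two elements
  beyond \<open>s\<close>, and \<open>t\<close> uses one of them, so the other yields
  \<open>r\<close>.\<close>

lemma second_intermediate_set:
  assumes "finite A" "card A = Suc (Suc j)" "s \<subseteq> t" "t \<subseteq> A" "card s = j" "card t = Suc j"
  shows "\<exists>r. r \<noteq> t \<and> s \<subseteq> r \<and> r \<subseteq> A \<and> card r = Suc j"
proof -
  obtain y where y: "y \<in> A" "y \<notin> t" using assms by (metis n_not_Suc_n subsetI subset_antisym)
  have "finite s" using assms finite_subset by metis
  then have "card (insert y s) = Suc j" using y assms by (auto simp: card_insert_if)
  then show ?thesis using y assms by (intro exI[of _ "insert y s"]) auto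
qed

text \<open>Gluing exchanges the boundary facet \<open>\<rho>\<close> for the facets of
  \<open>insert v \<rho>\<close> through \<open>v\<close>. A ridge that loses \<open>\<rho>\<close>
  gains its own cone from \<open>v\<close>, and ridges through \<open>v\<close> are handled inside
  the new simplex. Writing the dimension as \<open>Suc j\<close> gives these ridges exactly
  \<open>j\<close> elements.\<close>

lemma stacked_sphere_ridge_in_two_facets:
  assumes "stacked_ball (Suc j) B" "t \<in> boundary_facets (Suc j) B" "s \<subseteq> t" "card s = j"
  shows "\<exists>r\<in>boundary_facets (Suc j) B. r \<noteq> t \<and> s \<subseteq> r"
  using assms
proof (induction arbitrary: s t rule: stacked_ball_induct)
  case (Pow \<sigma>)
  note bd = boundary_facets_Pow[OF Pow.hyps]
  have "t \<subseteq> \<sigma>" "card t = Suc j" using Pow.prems(1) unfolding bd by auto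
  then show ?case
    using second_intermediate_set[of \<sigma> j s t] Pow.hyps Pow.prems(2,3) unfolding bd by auto
next
  case (extend B \<rho> v)
  note c = abstract_complexD[OF stacked_ball_complex[OF extend.hyps(1)]]
  note bd = boundary_facets_extend[OF extend.hyps]
  have \<rho>: "\<rho> \<in> B" "card \<rho> = Suc j" "finite \<rho>" "v \<notin> \<rho>"
    using extend.hyps c by (auto simp: boundary_facets_def)
  \<comment> \<open>The substitute for \<open>\<rho>\<close> as a boundary facet containing
    \<open>s\<close>.\<close>
  have new: "insert v s \<in> boundary_facets (Suc j) (B \<union> Pow (insert v \<rho>))" if "s \<subseteq> \<rho>"
    using that \<rho> extend.prems(3) finite_subset[of s \<rho>] unfolding bd by (auto simp: card_insert_if)
  consider "t \<in> boundary_facets (Suc j) B" "t \<noteq> \<rho>"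
    | "v \<in> t" "t \<subseteq> insert v \<rho>" "card t = Suc j"
    using extend.prems(1) unfolding bd by auto
  then show ?case
  proof cases
    case 1
    then obtain r where r: "r \<in> boundary_facets (Suc j) B" "r \<noteq> t" "s \<subseteq> r"
      using extend.IH[OF 1(1) extend.prems(2,3)] by blast
    show ?thesis
    proof (cases "r = \<rho>")
      case True
      moreover have "v \<notin> t" using 1 extend.hyps(3) by (auto simp: boundary_facets_def)
      ultimately show ?thesis using r by (intro bexI[OF _ new]) auto
    next
      case False
      then have "r \<in> boundary_facets (Suc j) (B \<union> Pow (insert v \<rho>))"
        using r(1) unfolding bd by simp
      then show ?thesis using r by (intro bexI[of _ r]) auto
    qed
  next
    case 2
    show ?thesis
    proof (cases "v \<in> s")
      case True
      have "card (insert v \<rho>) = Suc (Suc j)" using \<rho> by simp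
      then obtain r where "r \<noteq> t" "s \<subseteq> r" "r \<subseteq> insert v \<rho>" "card r = Suc j"
        using second_intermediate_set[of "insert v \<rho>" j s t] 2 extend.prems(2,3) \<rho>(3) by auto
      then show ?thesis using True unfolding bd by (intro bexI[of _ r]) auto
    next
      case False
      \<comment> \<open>The induction hypothesis is applied to \<open>\<rho>\<close> in place of
        \<open>t\<close>: the second old facet over \<open>s\<close> survives the gluing, and it
        differs from \<open>t\<close> because it avoids \<open>v\<close>.\<close>
      then have "s \<subseteq> \<rho>" using 2 extend.prems by auto
      then obtain r where r: "r \<in> boundary_facets (Suc j) B" "r \<noteq> \<rho>" "s \<subseteq> r"
        using extend.IH[OF extend.hyps(2) _ extend.prems(3)] by blast
      have "v \<notin> r" using r(1) extend.hyps(3) by (auto simp: boundary_facets_def)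
      then show ?thesis using 2(1) r unfolding bd by (intro bexI[of _ r]) auto
    qed
  qed
qed

section \<open>Embedding a ball in the boundary of a ball one dimension higher\<close>

text \<open>The first disjunct is the base of the induction: a single simplex has only
  \<open>d + 1\<close> vertices, too few for a stacked \<open>(d + 1)\<close>-ball on the same
  vertices. The ball \<open>C\<close> starts with the second facet.\<close>

lemma stacked_ball_in_boundary:
  assumes "stacked_ball d B"
  shows "(\<exists>\<sigma>. card \<sigma> = d + 1 \<and> B = Pow \<sigma>) \<or>
    (\<exists>C. stacked_ball (Suc d) C \<and> \<Union>C = \<Union>B \<and> B \<subseteq> ball_boundary (Suc d) C)"
  using assms
proof (induction rule: stacked_ball_induct)
  case (Pow \<sigma>)
  then show ?case by blast
next
  case (extend B \<tau> v)
  let ?B = "B \<union> Pow (insert v \<tau>)"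
  note c = abstract_complexD[OF stacked_ball_complex[OF extend.hyps(1)]]
  have \<tau>: "\<tau> \<in> B" "card \<tau> = d" "finite \<tau>" "v \<notin> \<tau>" "in_exactly_one_facet d B \<tau>"
    using extend.hyps c by (auto simp: boundary_facets_def)
  have vt: "card (insert v \<tau>) = Suc d" using \<tau> by simp
  have "\<exists>C. stacked_ball (Suc d) C \<and> \<Union>C = \<Union>?B \<and> ?B \<subseteq> ball_boundary (Suc d) C"
    using extend.IH
  proof
    assume "\<exists>\<sigma>. card \<sigma> = d + 1 \<and> B = Pow \<sigma>"
    then obtain \<sigma> where \<sigma>: "card \<sigma> = d + 1" "B = Pow \<sigma>" by blast
    have fin: "finite (insert v \<sigma>)" using \<sigma> by (simp add: card_ge_0_finite)
    moreover have card: "card (insert v \<sigma>) = Suc d + 1" using \<sigma> fin extend.hyps by auto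
    ultimately have C: "stacked_ball (Suc d) (Pow (insert v \<sigma>))" by (intro stacked_ball_Pow) auto
    have "\<tau> \<subseteq> \<sigma>" using \<tau> \<sigma> by auto
    \<comment> \<open>In a single simplex every ridge is free, and both facets of the new ball are
      ridges of \<open>insert v \<sigma>\<close>.\<close>
    then have "{\<sigma>, insert v \<tau>} \<subseteq> boundary_facets (Suc d) (Pow (insert v \<sigma>))"
      using boundary_facets_Pow[OF fin card] vt \<sigma> by auto
    then have "?B \<subseteq> ball_boundary (Suc d) (Pow (insert v \<sigma>))"
      using \<sigma>(2) unfolding ball_boundary_eq by blast
    moreover have "\<Union>(Pow (insert v \<sigma>)) = \<Union>?B" using \<sigma> \<open>\<tau> \<subseteq> \<sigma>\<close> by auto
    ultimately show ?thesis using C by blast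
  next
    assume "\<exists>C. stacked_ball (Suc d) C \<and> \<Union>C = \<Union>B \<and> B \<subseteq> ball_boundary (Suc d) C"
    then obtain C where C: "stacked_ball (Suc d) C" "\<Union>C = \<Union>B"
      and sub: "B \<subseteq> ball_boundary (Suc d) C" by blast
    \<comment> \<open>Boundary facets of \<open>C\<close> have \<open>d + 1\<close> elements, so
      those lying in \<open>B\<close> are facets of \<open>B\<close>, and \<open>\<tau>\<close> is
      in only one of these.\<close>
    have unique: "r = r'" if "r \<in> B" "r' \<in> B" "\<tau> \<subseteq> r" "\<tau> \<subseteq> r'"
      "r \<in> boundary_facets (Suc d) C" "r' \<in> boundary_facets (Suc d) C" for r r'
      using \<tau>(5) that unfolding in_exactly_one_facet_def
      by (auto simp: facets_def boundary_facets_def)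
    obtain \<rho> where \<rho>: "\<rho> \<in> boundary_facets (Suc d) C" "\<tau> \<subseteq> \<rho>" "\<rho> \<notin> B"
    proof -
      obtain r where r: "r \<in> boundary_facets (Suc d) C" "\<tau> \<subseteq> r"
        using sub \<tau>(1) unfolding ball_boundary_eq by blast
      then obtain r' where "r' \<in> boundary_facets (Suc d) C" "r' \<noteq> r" "\<tau> \<subseteq> r'"
        using stacked_sphere_ridge_in_two_facets[OF C(1) r(1,2) \<tau>(2)] by blast
      then show thesis using that r unique by metis
    qed
    have v: "v \<notin> \<Union>C" using C extend.hyps by simp
    note bd = boundary_facets_extend[OF C(1) \<rho>(1) v]
    let ?C = "C \<union> Pow (insert v \<rho>)"
    have "\<rho> \<in> C" using \<rho> by (simp add: boundary_facets_def)
    have "insert v \<tau> \<in> boundary_facets (Suc d) ?C"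
      unfolding bd using \<rho> vt by auto
    \<comment> \<open>Each facet of \<open>B\<close> is, by cardinality, itself a boundary facet of
      \<open>C\<close>. It survives the gluing because the only one removed, \<open>\<rho>\<close>,
      is not in \<open>B\<close>.\<close>
    moreover have "\<exists>r\<in>boundary_facets (Suc d) ?C. b \<subseteq> r" if b: "b \<in> B" for b
    proof -
      obtain g where g: "g \<in> facets d B" "b \<subseteq> g"
        using pure_complex_face_in_facet[OF stacked_ball_pure[OF extend.hyps(1)] b] by blast
      then have gB: "g \<in> B" "card g = Suc d" by (auto simp: facets_def)
      then obtain r where r: "r \<in> boundary_facets (Suc d) C" "g \<subseteq> r"
        using sub unfolding ball_boundary_eq by blast
      then have "finite r" "card r = Suc d"
        using abstract_complexD(3)[OF stacked_ball_complex[OF C(1)]]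
        by (auto simp: boundary_facets_def)
      then have "g = r" using r gB card_subset_eq by metis
      then show ?thesis using r g gB \<rho> unfolding bd by blast
    qed
    ultimately have "?B \<subseteq> ball_boundary (Suc d) ?C" unfolding ball_boundary_eq by blast
    moreover have "stacked_ball (Suc d) ?C" using stacked_ball_extend[OF C(1) \<rho>(1) v] .
    moreover have "\<Union>?C = \<Union>?B"
    proof -
      have "\<rho> \<subseteq> \<Union>B" "\<tau> \<subseteq> \<Union>B" using \<open>\<rho> \<in> C\<close> \<tau> C(2) by auto
      moreover have "\<Union>?C = insert v (\<rho> \<union> \<Union>C)" "\<Union>?B = insert v (\<tau> \<union> \<Union>B)" by auto
      ultimately show ?thesis by (simp only: C(2) Un_absorb1)
    qed
    ultimately show ?thesis by (intro exI[of _ ?C] conjI)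
  qed
  then show ?case by blast
qed

section \<open>Transport along injective vertex maps\<close>

text \<open>Injectivity on the vertices makes the image map on faces preserve cardinality and both
  preserve and reflect inclusion; free ridges are defined from these data alone.\<close>

lemma boundary_facets_image:
  assumes f: "inj_on f (\<Union>B)"
  shows "boundary_facets k ((`) f ` B) = (`) f ` boundary_facets k B"
proof -
  have inj: "inj_on f \<sigma>" if "\<sigma> \<in> B" for \<sigma> using f that by (auto intro: inj_on_subset)
  have sub: "f ` \<tau> \<subseteq> f ` \<sigma> \<longleftrightarrow> \<tau> \<subseteq> \<sigma>" if "\<tau> \<in> B" "\<sigma> \<in> B" for \<tau> \<sigma>
    using that f unfolding inj_on_def by blast
  have card: "card (f ` \<sigma>) = card \<sigma>" if "\<sigma> \<in> B" for \<sigma> using that inj card_image by blast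
  have fac: "facets k ((`) f ` B) = (`) f ` facets k B"
    using card by (auto simp: facets_def)
  have FB: "facets k B \<subseteq> B" by (auto simp: facets_def)
  have "in_exactly_one_facet k ((`) f ` B) (f ` \<tau>) \<longleftrightarrow> in_exactly_one_facet k B \<tau>"
    if "\<tau> \<in> B" for \<tau>
  proof -
    have "f ` \<sigma> = f ` \<sigma>' \<longleftrightarrow> \<sigma> = \<sigma>'" if "\<sigma> \<in> B" "\<sigma>' \<in> B" for \<sigma> \<sigma>'
      using sub that by blast
    then show ?thesis unfolding in_exactly_one_facet_def fac
      using sub[OF that] FB by (smt (verit, best) image_iff subset_iff)
  qed
  then show ?thesis using card by (auto simp: boundary_facets_def)
qed

lemma ball_boundary_image:
  assumes f: "inj_on f (\<Union>B)"
  shows "ball_boundary k ((`) f ` B) = (`) f ` ball_boundary k B"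
  unfolding ball_boundary_eq boundary_facets_image[OF f] by (simp add: image_UN image_Pow_surj[OF refl])

lemma stacked_ball_image:
  assumes "stacked_ball k B" "inj_on f (\<Union>B)"
  shows "stacked_ball k ((`) f ` B)"
  using assms
proof (induction rule: stacked_ball_induct)
  case (Pow \<sigma>)
  then have "card (f ` \<sigma>) = k + 1" using card_image[of f \<sigma>] by simp
  then show ?case using Pow stacked_ball_Pow[of "f ` \<sigma>" k] by (simp add: image_Pow_surj)
next
  case (extend B \<tau> v)
  have "\<tau> \<in> B" using extend.hyps by (simp add: boundary_facets_def)
  have inj: "inj_on f (\<Union>B)" using extend.prems by (rule inj_on_subset) auto
  \<comment> \<open>Injectivity keeps the image of the new vertex new, so the stacking step can be
    repeated in the image.\<close>
  have "f v \<notin> f ` \<Union>B" using extend.prems extend.hyps(3) unfolding inj_on_def by auto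
  then have fv: "f v \<notin> \<Union>((`) f ` B)" by auto
  have "f ` \<tau> \<in> boundary_facets k ((`) f ` B)"
    unfolding boundary_facets_image[OF inj] using extend.hyps by blast
  then have "stacked_ball k ((`) f ` B \<union> Pow (insert (f v) (f ` \<tau>)))"
    using stacked_ball_extend[OF extend.IH[OF inj] _ fv] by simp
  moreover have "(`) f ` (B \<union> Pow (insert v \<tau>)) = (`) f ` B \<union> Pow (insert (f v) (f ` \<tau>))"
    by (simp only: image_Un image_Pow_surj[OF refl] image_insert)
  ultimately show ?case by simp
qed

lemma abstract_complex_image:
  assumes "abstract_complex K"
  shows "abstract_complex ((`) f ` K)"
  using assms unfolding abstract_complex_def
  by (auto simp: subset_image_iff)

lemma isomorphic_complexes_image:
  assumes "abstract_complex K" "inj_on f (\<Union>K)"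
  shows "isomorphic_complexes K ((`) f ` K)"
proof -
  note c = abstract_complex_image[OF assms(1), of f]
  have "\<Union>((`) f ` K) = f ` \<Union>K" by auto
  then have "bij_betw f (complex_vertices K) (complex_vertices ((`) f ` K))"
    using assms by (simp add: complex_vertices_eq_Union c bij_betw_def)
  then show ?thesis using assms c by (auto simp: isomorphic_complexes_def)
qed

section \<open>Boundaries as stacked spheres\<close>

lemma ball_boundary_subset:
  assumes "abstract_complex B"
  shows "ball_boundary k B \<subseteq> B"
  using abstract_complexD(4)[OF assms] by (auto simp: ball_boundary_eq boundary_facets_def)

lemma abstract_complex_ball_boundary:
  assumes "abstract_complex B" "ball_boundary k B \<noteq> {}"
  shows "abstract_complex (ball_boundary k B)"
proof -
  note sub = ball_boundary_subset[OF assms(1), of k]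
  have "finite (ball_boundary k B)"
    using sub abstract_complexD(1)[OF assms(1)] by (rule finite_subset)
  moreover have "finite \<sigma>" if "\<sigma> \<in> ball_boundary k B" for \<sigma>
    using sub that abstract_complexD(3)[OF assms(1)] by blast
  moreover have "\<tau> \<in> ball_boundary k B" if "\<sigma> \<in> ball_boundary k B" "\<tau> \<subseteq> \<sigma>" for \<sigma> \<tau>
    using that unfolding ball_boundary_eq by blast
  ultimately show ?thesis using assms(2) unfolding abstract_complex_def by blast
qed

text \<open>\<open>stacked_sphere\<close> asks for a bounding ball on \<open>nat\<close>, so
  \<open>C\<close> is relabelled by an injection of its finite vertex set. Nonemptiness of the
  boundary is assumed because \<open>abstract_complex\<close> excludes the empty family.\<close>

lemma stacked_sphere_ball_boundary:
  assumes C: "stacked_ball (Suc k) C" and "ball_boundary (Suc k) C \<noteq> {}"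
  shows "stacked_sphere k (ball_boundary (Suc k) C)"
proof -
  let ?S = "ball_boundary (Suc k) C"
  note cC = stacked_ball_complex[OF C]
  have cS: "abstract_complex ?S" using abstract_complex_ball_boundary[OF cC] assms(2) .
  have "finite (\<Union>C)" using abstract_complexD[OF cC] by auto
  then obtain f :: "'a \<Rightarrow> nat" where f: "inj_on f (\<Union>C)"
    using finite_imp_inj_to_nat_seg by blast
  have "inj_on f (\<Union>?S)"
    using ball_boundary_subset[OF cC, of "Suc k"] by (intro inj_on_subset[OF f]) auto
  then have "isomorphic_complexes ?S (ball_boundary (Suc k) ((`) f ` C))"
    using isomorphic_complexes_image[OF cS] ball_boundary_image[OF f, of "Suc k"] by simp
  then show ?thesis using stacked_ball_image[OF C f] unfolding stacked_sphere_def by auto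
qed

theorem lemma7:
  fixes B :: "'a set set" and n d :: nat
  assumes "stacked_ball d B"
    and "card (complex_vertices B) = n"
    and "d \<ge> 2"
    and "n \<ge> d + 2"
  shows "\<exists>S :: 'a set set. stacked_sphere d S \<and> card (complex_vertices S) = n \<and>
           subcomplex B S \<and> complex_vertices B = complex_vertices S"
proof -
  note cB = stacked_ball_complex[OF assms(1)]
  \<comment> \<open>The bound \<open>n \<ge> d + 2\<close> rules out the single simplex, leaving the
    case with a ball \<open>C\<close>.\<close>
  have "card (\<Union>B) \<noteq> d + 1"
    using assms(2,4) by (simp add: complex_vertices_eq_Union[OF cB])
  then have "B \<noteq> Pow \<sigma>" if "card \<sigma> = d + 1" for \<sigma>
    using that Union_Pow_eq[of \<sigma>] by metis
  then obtain C where C: "stacked_ball (Suc d) C" "\<Union>C = \<Union>B"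
    and sub: "B \<subseteq> ball_boundary (Suc d) C"
    using stacked_ball_in_boundary[OF assms(1)] by blast
  let ?S = "ball_boundary (Suc d) C"
  note cC = stacked_ball_complex[OF C(1)]
  have ne: "?S \<noteq> {}" using sub abstract_complexD(2)[OF cB] by auto
  have cS: "abstract_complex ?S" using abstract_complex_ball_boundary[OF cC ne] .
  \<comment> \<open>The sphere lies between \<open>B\<close> and \<open>C\<close>, which have the
    same vertices.\<close>
  have "\<Union>?S = \<Union>B" using ball_boundary_subset[OF cC, of "Suc d"] sub C(2) by blast
  then have "complex_vertices B = complex_vertices ?S"
    using cB cS by (simp add: complex_vertices_eq_Union)
  moreover have "subcomplex B ?S" using cB cS sub by (simp add: subcomplex_def)
  ultimately show ?thesis
    using stacked_sphere_ball_boundary[OF C(1) ne] assms(2) by (intro exI[of _ ?S]) simp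
qed

end
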